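(* Let $\Sigma \subseteq \mathcal{L}_{\mathsf{Ldm}}$ be $\mathsf{Ldm}$-consistent. Then $\Sigma$ is satisfiable: there exist a $\mathsf{Tstit}$-model $M$ and a world $w$ of $M$ such that $M, w \models \phi$ for every $\phi \in \Sigma$.
   Context: Fix a finite set of agents $Ag=\{1,\dots,n\}$ and a countable set $Var$ of propositional variables. Formulas are in negation normal form. $\mathcal{L}_{\mathsf{Ldm}}$: $\phi ::= p \mid \overline{p} \mid \phi\wedge\phi \mid \phi\vee\phi \mid \Box\phi \mid \Diamond\phi \mid [i]\phi \mid \langle i\rangle\phi$ with $p\in Var$, $i \in Ag$. The negation $\overline{\phi}$ of a formula is obtained by swapping every operator with its dual ($\wedge/\vee$, $\Box/\Diamond$, $[i]/\langle i\rangle$) and every $p$ with $\overline{p}$. Abbreviations: $\phi\to\psi := \overline{\phi}\vee\psi$, $\phi\leftrightarrow\psi := (\phi\to\psi)\wedge(\psi\to\phi)$, $\top := p\vee\overline p$, $\bot := p\wedge\overline p$. The Hilbert system $\mathsf{Ldm}$ has axioms (all instances): $\phi\to(\psi\to\phi)$; $(\overline\psi\to\overline\phi)\to(\phi\to\psi)$; $(\phi\to(\psi\to\chi))\to((\phi\to\psi)\to(\phi\to\chi))$; $\Box\phi\to\phi$; $\Diamond\phi\to\Box\Diamond\phi$; $\Box(\phi\to\psi)\to(\Box\phi\to\Box\psi)$; $[i]\phi\to\phi$; $\langle i\rangle\phi\to[i]\langle i\rangle\phi$; $\Box\phi\vee\Diamond\overline\phi$; $[i]\phi\vee\langle i\rangle\overline\phi$;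 $\bigwedge_{i\in Ag}\Diamond[i]\phi_i \to \Diamond(\bigwedge_{i\in Ag}[i]\phi_i)$; $[i](\phi\to\psi)\to([i]\phi\to[i]\psi)$; $\Box\phi\to[i]\phi$; and rules: from $\phi$ infer $\Box\phi$; from $\phi$ and $\phi\to\psi$ infer $\psi$. $\vdash_{\mathsf{Ldm}}\phi$ means $\phi$ is a theorem. A set $\Sigma$ is $\mathsf{Ldm}$-consistent iff $\Sigma\not\vdash_{\mathsf{Ldm}}\bot$, i.e. there is no finite $\{\sigma_1,\dots,\sigma_k\}\subseteq\Sigma$ with $\vdash_{\mathsf{Ldm}} (\sigma_1\wedge\dots\wedge\sigma_k)\to\bot$. A $\mathsf{Tstit}$-frame is a tuple $(W,\mathcal{R}_\Box,\{\mathcal{R}_i\}_{i\in Ag},\mathcal{R}_{Ag},\mathcal{R}_{\mathsf G},\mathcal{R}_{\mathsf H})$ with $W\neq\emptyset$, where $\mathcal{R}_\Box$, each $\mathcal{R}_i$, and $\mathcal{R}_{Ag}$ are equivalence relations on $W$ (write $\mathcal{R}(w)=\{v : (w,v)\in\mathcal{R}\}$) such that: (C1) $\mathcal{R}_i\subseteq\mathcal{R}_\Box$ for each $i$; (C2) for all $u_1,\dots,u_n\in W$, if $\mathcal{R}_\Box u_iu_j$ for all $1\le i,j\le n$ then $\bigcap_i\mathcal{R}_i(u_i)\neq\emptyset$; (C3) $\mathcal{R}_{Ag}(w)=\bigcap_{i\in Ag}\mathcal{R}_i(w)$ for all $w$; $\mathcal{R}_{\mathsf G}$ is transitive and serial and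 $\mathcal{R}_{\mathsf H}$ is its converse; (C4) if $\mathcal{R}_{\mathsf G}wu$ and $\mathcal{R}_{\mathsf G}wv$ then $\mathcal{R}_{\mathsf G}uv$ or $u=v$ or $\mathcal{R}_{\mathsf G}vu$; (C5) the same for $\mathcal{R}_{\mathsf H}$; (C6) $\mathcal{R}_{\mathsf G}\circ\mathcal{R}_\Box\subseteq\mathcal{R}_{Ag}\circ\mathcal{R}_{\mathsf G}$; (C7) if $u\in\mathcal{R}_\Box(w)$ then $u\notin\mathcal{R}_{\mathsf G}(w)$. A $\mathsf{Tstit}$-model adds a valuation $V:Var\to\mathcal{P}(W)$. Satisfaction: $w\models p$ iff $w\in V(p)$; $w\models\overline p$ iff $w\notin V(p)$; $\wedge,\vee$ as usual; $w\models\Box\phi$ iff all $u\in\mathcal{R}_\Box(w)$ satisfy $\phi$; $w\models\Diamond\phi$ iff some $u\in\mathcal{R}_\Box(w)$ satisfies $\phi$; likewise $[i]$/$\langle i\rangle$ with $\mathcal{R}_i$. *)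

theory Defs
  imports Main "HOL-Library.Countable"
begin

text \<open>
  The set of agents \<open>Ag = {1,\<dots>,n}\<close> is a type \<open>'i\<close> of class \<open>{finite,linorder}\<close>: such a type is
  order isomorphic to \<open>{1,\<dots>,n}\<close> with \<open>n = CARD('i) \<ge> 1\<close>. The order only serves to write conjunctions
  over all agents as formulas.
\<close>

subsection \<open>Formulas\<close>

datatype ('v, 'i) fm =
    Pos 'v
  | Neg 'v
  | And "('v, 'i) fm" "('v, 'i) fm"  (infixr "\<^bold>\<and>" 35)
  | Or "('v, 'i) fm" "('v, 'i) fm"  (infixr "\<^bold>\<or>" 30)
  | Box "('v, 'i) fm"
  | Dia "('v, 'i) fm"
  | AgBox 'i "('v, 'i) fm"
  | AgDia 'i "('v, 'i) fm"

primrec neg :: "('v, 'i) fm \<Rightarrow> ('v, 'i) fm" where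
  "neg (Pos p) = Neg p"
| "neg (Neg p) = Pos p"
| "neg (\<phi> \<^bold>\<and> \<psi>) = (neg \<phi> \<^bold>\<or> neg \<psi>)"
| "neg (\<phi> \<^bold>\<or> \<psi>) = (neg \<phi> \<^bold>\<and> neg \<psi>)"
| "neg (Box \<phi>) = Dia (neg \<phi>)"
| "neg (Dia \<phi>) = Box (neg \<phi>)"
| "neg (AgBox i \<phi>) = AgDia i (neg \<phi>)"
| "neg (AgDia i \<phi>) = AgBox i (neg \<phi>)"

abbreviation Imp :: "('v, 'i) fm \<Rightarrow> ('v, 'i) fm \<Rightarrow> ('v, 'i) fm"  (infixr "\<^bold>\<longrightarrow>" 25)
  where "\<phi> \<^bold>\<longrightarrow> \<psi> \<equiv> neg \<phi> \<^bold>\<or> \<psi>"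

text \<open>Here \<open>undefined :: 'v\<close> is a fixed but arbitrary propositional variable.\<close>

definition Top :: "('v, 'i) fm" where
  "Top = (Pos undefined \<^bold>\<or> Neg undefined)"

definition Bot :: "('v, 'i) fm" where
  "Bot = (Pos undefined \<^bold>\<and> Neg undefined)"

fun conj_list :: "('v, 'i) fm list \<Rightarrow> ('v, 'i) fm" where
  "conj_list [] = Top"
| "conj_list [\<phi>] = \<phi>"
| "conj_list (\<phi> # \<psi> # \<phi>s) = (\<phi> \<^bold>\<and> conj_list (\<psi> # \<phi>s))"

definition conj_agents :: "('i::{finite,linorder} \<Rightarrow> ('v, 'i) fm) \<Rightarrow> ('v, 'i) fm" where
  "conj_agents f = conj_list (map f (sorted_list_of_set UNIV))"

subsection \<open>The Hilbert system\<close>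

inductive ldm :: "('v, 'i::{finite,linorder}) fm \<Rightarrow> bool"  ("\<turnstile> _" [20] 20) where
  A1: "\<turnstile> \<phi> \<^bold>\<longrightarrow> (\<psi> \<^bold>\<longrightarrow> \<phi>)"
| A2: "\<turnstile> (neg \<psi> \<^bold>\<longrightarrow> neg \<phi>) \<^bold>\<longrightarrow> (\<phi> \<^bold>\<longrightarrow> \<psi>)"
| A3: "\<turnstile> (\<phi> \<^bold>\<longrightarrow> (\<psi> \<^bold>\<longrightarrow> \<chi>)) \<^bold>\<longrightarrow> ((\<phi> \<^bold>\<longrightarrow> \<psi>) \<^bold>\<longrightarrow> (\<phi> \<^bold>\<longrightarrow> \<chi>))"
| Box_T: "\<turnstile> Box \<phi> \<^bold>\<longrightarrow> \<phi>"
| Box_5: "\<turnstile> Dia \<phi> \<^bold>\<longrightarrow> Box (Dia \<phi>)"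
| Box_K: "\<turnstile> Box (\<phi> \<^bold>\<longrightarrow> \<psi>) \<^bold>\<longrightarrow> (Box \<phi> \<^bold>\<longrightarrow> Box \<psi>)"
| AgBox_T: "\<turnstile> AgBox i \<phi> \<^bold>\<longrightarrow> \<phi>"
| AgBox_5: "\<turnstile> AgDia i \<phi> \<^bold>\<longrightarrow> AgBox i (AgDia i \<phi>)"
| Box_dual: "\<turnstile> Box \<phi> \<^bold>\<or> Dia (neg \<phi>)"
| AgBox_dual: "\<turnstile> AgBox i \<phi> \<^bold>\<or> AgDia i (neg \<phi>)"
| IOA: "\<turnstile> conj_agents (\<lambda>i. Dia (AgBox i (\<Phi> i))) \<^bold>\<longrightarrow> Dia (conj_agents (\<lambda>i. AgBox i (\<Phi> i)))"
| AgBox_K: "\<turnstile> AgBox i (\<phi> \<^bold>\<longrightarrow> \<psi>) \<^bold>\<longrightarrow> (AgBox i \<phi> \<^bold>\<longrightarrow> AgBox i \<psi>)"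
| Bridge: "\<turnstile> Box \<phi> \<^bold>\<longrightarrow> AgBox i \<phi>"
| Nec: "\<turnstile> \<phi> \<Longrightarrow> \<turnstile> Box \<phi>"
| MP: "\<turnstile> \<phi> \<Longrightarrow> \<turnstile> \<phi> \<^bold>\<longrightarrow> \<psi> \<Longrightarrow> \<turnstile> \<psi>"

definition ldm_consistent :: "('v, 'i::{finite,linorder}) fm set \<Rightarrow> bool" where
  "ldm_consistent \<Sigma> \<longleftrightarrow> \<not> (\<exists>\<sigma>s. set \<sigma>s \<subseteq> \<Sigma> \<and> (\<turnstile> conj_list \<sigma>s \<^bold>\<longrightarrow> Bot))"

subsection \<open>Temporal STIT frames and models\<close>

record ('w, 'i) frame =
  W :: "'w set"
  RBox :: "('w \<times> 'w) set"
  R :: "'i \<Rightarrow> ('w \<times> 'w) set"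
  RAg :: "('w \<times> 'w) set"
  RG :: "('w \<times> 'w) set"
  RH :: "('w \<times> 'w) set"

text \<open>
  Relation composition \<open>O\<close> reads from left to right: the penultimate condition says that whenever
  \<open>RG w v\<close> and \<open>RBox v u\<close>, there is a \<open>z\<close> with \<open>RAg w z\<close> and \<open>RG z u\<close>.
\<close>

definition tstit_frame :: "('w, 'i::finite, 'm) frame_scheme \<Rightarrow> bool" where
  "tstit_frame F \<longleftrightarrow>
     W F \<noteq> {} \<and>
     equiv (W F) (RBox F) \<and>
     (\<forall>i. equiv (W F) (R F i)) \<and>
     equiv (W F) (RAg F) \<and>
     (\<forall>i. R F i \<subseteq> RBox F) \<and>
     (\<forall>u. (\<forall>i. u i \<in> W F) \<and> (\<forall>i j. (u i, u j) \<in> RBox F) \<longrightarrow> (\<Inter>i. R F i `` {u i}) \<noteq> {}) \<and>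
     (\<forall>w\<in>W F. RAg F `` {w} = (\<Inter>i. R F i `` {w})) \<and>
     RG F \<subseteq> W F \<times> W F \<and>
     trans (RG F) \<and>
     (\<forall>w\<in>W F. \<exists>v\<in>W F. (w, v) \<in> RG F) \<and>
     RH F = (RG F)\<inverse> \<and>
     (\<forall>w u v. (w, u) \<in> RG F \<and> (w, v) \<in> RG F \<longrightarrow> (u, v) \<in> RG F \<or> u = v \<or> (v, u) \<in> RG F) \<and>
     (\<forall>w u v. (w, u) \<in> RH F \<and> (w, v) \<in> RH F \<longrightarrow> (u, v) \<in> RH F \<or> u = v \<or> (v, u) \<in> RH F) \<and>
     RG F O RBox F \<subseteq> RAg F O RG F \<and>
     (\<forall>w u. u \<in> RBox F `` {w} \<longrightarrow> u \<notin> RG F `` {w})"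

record ('w, 'i, 'v) model = "('w, 'i) frame" +
  V :: "'v \<Rightarrow> 'w set"

definition tstit_model :: "('w, 'i::finite, 'v) model \<Rightarrow> bool" where
  "tstit_model M \<longleftrightarrow> tstit_frame M \<and> (\<forall>p. V M p \<subseteq> W M)"

primrec sat :: "('w, 'i, 'v) model \<Rightarrow> 'w \<Rightarrow> ('v, 'i) fm \<Rightarrow> bool" where
  "sat M w (Pos p) \<longleftrightarrow> w \<in> V M p"
| "sat M w (Neg p) \<longleftrightarrow> w \<notin> V M p"
| "sat M w (\<phi> \<^bold>\<and> \<psi>) \<longleftrightarrow> sat M w \<phi> \<and> sat M w \<psi>"
| "sat M w (\<phi> \<^bold>\<or> \<psi>) \<longleftrightarrow> sat M w \<phi> \<or> sat M w \<psi>"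
| "sat M w (Box \<phi>) \<longleftrightarrow> (\<forall>u \<in> RBox M `` {w}. sat M u \<phi>)"
| "sat M w (Dia \<phi>) \<longleftrightarrow> (\<exists>u \<in> RBox M `` {w}. sat M u \<phi>)"
| "sat M w (AgBox i \<phi>) \<longleftrightarrow> (\<forall>u \<in> R M i `` {w}. sat M u \<phi>)"
| "sat M w (AgDia i \<phi>) \<longleftrightarrow> (\<exists>u \<in> R M i `` {w}. sat M u \<phi>)"

text \<open>
  An existential quantifier cannot range over types, so the existence of a model is stated for
  worlds drawn from the following type, which has room for countably many copies of every set of
  formulas.
\<close>

type_synonym ('v, 'i) world = "('v, 'i) fm set \<times> nat"

end

theory Submission
  imports Defs
begin

text \<open>
  The canonical model of \<open>Ldm\<close>, built from the maximal consistent sets, satisfies the purely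
  agentive conditions, (C2) by the axiom IOA. It becomes a temporal frame by taking \<open>\<omega>\<close> copies of it
  as moments in time: every maximal consistent set is a history of its own, moment \<open>0\<close> carries the
  canonical relations, and at all later moments the agentive relations are the identity. Then (C6)
  holds trivially because anything related to a future world is that world itself. The language of
  \<open>Ldm\<close> cannot see beyond moment \<open>0\<close>.
\<close>

subsection \<open>Derivations from premises\<close>

text \<open>Necessitation enters only through \<open>provable\<close>, never on hypotheses; this is
  what makes the deduction theorem hold.\<close>

inductive derives :: "('v, 'i::{finite,linorder}) fm set \<Rightarrow> ('v, 'i) fm \<Rightarrow> bool"
    (infix "\<tturnstile>" 55) for S where
  provable: "\<turnstile> \<phi> \<Longrightarrow> S \<tturnstile> \<phi>"
| hyp: "\<phi> \<in> S \<Longrightarrow> S \<tturnstile> \<phi>"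
| mp: "S \<tturnstile> \<phi> \<Longrightarrow> S \<tturnstile> (\<phi> \<^bold>\<longrightarrow> \<psi>) \<Longrightarrow> S \<tturnstile> \<psi>"

lemma neg_neg [simp]: "neg (neg \<phi>) = \<phi>"
  by (induction \<phi>) auto

lemma derives_cut: "S \<tturnstile> \<phi> \<Longrightarrow> (\<And>\<psi>. \<psi> \<in> S \<Longrightarrow> T \<tturnstile> \<psi>) \<Longrightarrow> T \<tturnstile> \<phi>"
  by (induction rule: derives.induct) (auto intro: derives.intros)

lemma derives_mono: "S \<tturnstile> \<phi> \<Longrightarrow> S \<subseteq> T \<Longrightarrow> T \<tturnstile> \<phi>"
  by (blast intro: derives_cut hyp)

lemma derives_empty: "{} \<tturnstile> \<phi> \<Longrightarrow> \<turnstile> \<phi>"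
  by (induction rule: derives.induct) (auto intro: MP)

lemma derives_compact: "S \<tturnstile> \<phi> \<Longrightarrow> \<exists>L. set L \<subseteq> S \<and> set L \<tturnstile> \<phi>"
proof (induction rule: derives.induct)
  case (provable \<phi>)
  then have "set [] \<subseteq> S \<and> set [] \<tturnstile> \<phi>" by (auto intro: derives.provable)
  then show ?case by blast
next
  case (hyp \<phi>)
  then have "set [\<phi>] \<subseteq> S \<and> set [\<phi>] \<tturnstile> \<phi>" by (auto intro: derives.hyp)
  then show ?case by blast
next
  case (mp \<phi> \<psi>)
  then obtain L K where "set L \<subseteq> S" "set L \<tturnstile> \<phi>" "set K \<subseteq> S" "set K \<tturnstile> (\<phi> \<^bold>\<longrightarrow> \<psi>)" by blast
  then have "set (L @ K) \<subseteq> S \<and> set (L @ K) \<tturnstile> \<psi>"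
    by (auto intro: derives.mp[of _ \<phi>] elim: derives_mono)
  then show ?case by blast
qed

lemma Imp_refl: "\<turnstile> \<phi> \<^bold>\<longrightarrow> \<phi>"
  by (rule MP[OF A1[of \<phi> \<phi>] MP[OF A1 A3]])

lemma deduction: "insert \<phi> S \<tturnstile> \<psi> \<Longrightarrow> S \<tturnstile> (\<phi> \<^bold>\<longrightarrow> \<psi>)"
proof (induction rule: derives.induct)
  case (provable \<psi>)
  then show ?case by (intro derives.provable MP[OF _ A1])
next
  case (hyp \<psi>)
  then show ?case
    using derives.mp[OF derives.hyp derives.provable[OF A1]] derives.provable[OF Imp_refl] by blast
next
  case (mp \<psi> \<chi>)
  show ?case by (rule derives.mp[OF mp.IH(1) derives.mp[OF mp.IH(2) derives.provable[OF A3]]])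
qed

section \<open>Contradiction and conjunction\<close>

lemma explosion:
  assumes "S \<tturnstile> \<phi>" "S \<tturnstile> neg \<phi>"
  shows "S \<tturnstile> \<psi>"
proof -
  have "S \<tturnstile> (neg \<psi> \<^bold>\<longrightarrow> neg \<phi>)" using assms(2) provable[OF A1] by (rule mp)
  then have "S \<tturnstile> (\<phi> \<^bold>\<longrightarrow> \<psi>)" using provable[OF A2] by (rule mp)
  with assms(1) show ?thesis by (rule mp)
qed

text \<open>Syntactically, \<open>neg Bot\<close> is the implication from
  \<open>Pos undefined\<close> to itself.\<close>

lemma neg_Bot: "\<turnstile> neg Bot"
  using Imp_refl[of "Pos undefined"] by (simp add: Bot_def)

lemma by_contradiction:
  assumes "insert (neg \<phi>) S \<tturnstile> Bot"
  shows "S \<tturnstile> \<phi>"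
proof -
  \<comment> \<open>Writing \<open>Bot\<close> as \<open>neg (neg Bot)\<close> gives the implication
    the contrapositive shape that \<open>A2\<close> expects.\<close>
  have "S \<tturnstile> (neg \<phi> \<^bold>\<longrightarrow> neg (neg Bot))" using deduction[OF assms] by simp
  then have "S \<tturnstile> (neg Bot \<^bold>\<longrightarrow> \<phi>)" using provable[OF A2] by (rule mp)
  with provable[OF neg_Bot] show ?thesis by (rule mp)
qed

text \<open>Since \<open>neg (\<phi> \<^bold>\<and> \<psi>)\<close> is the formula \<open>\<phi> \<^bold>\<longrightarrow> neg \<psi>\<close>, conjunctions are handled by contraposition.\<close>

lemma And_left: "{\<phi> \<^bold>\<and> \<psi>} \<tturnstile> \<phi>"
proof (rule by_contradiction)
  let ?S = "{neg \<phi>, \<phi> \<^bold>\<and> \<psi>}"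
  have "insert \<phi> ?S \<tturnstile> neg \<psi>" by (rule explosion[of _ \<phi>]) (auto intro: hyp)
  then have "?S \<tturnstile> neg (\<phi> \<^bold>\<and> \<psi>)" using deduction by auto
  then show "?S \<tturnstile> Bot" by (rule explosion[rotated]) (auto intro: hyp)
qed

lemma And_right: "{\<phi> \<^bold>\<and> \<psi>} \<tturnstile> \<psi>"
proof (rule by_contradiction)
  let ?S = "{neg \<psi>, \<phi> \<^bold>\<and> \<psi>}"
  have "insert \<phi> ?S \<tturnstile> neg \<psi>" by (auto intro: hyp)
  then have "?S \<tturnstile> neg (\<phi> \<^bold>\<and> \<psi>)" using deduction by auto
  then show "?S \<tturnstile> Bot" by (rule explosion[rotated]) (auto intro: hyp)
qed

lemma And_intro:
  assumes "S \<tturnstile> \<phi>" "S \<tturnstile> \<psi>"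
  shows "S \<tturnstile> (\<phi> \<^bold>\<and> \<psi>)"
proof (rule by_contradiction)
  let ?S = "insert (neg (\<phi> \<^bold>\<and> \<psi>)) S"
  have "?S \<tturnstile> \<phi>" "?S \<tturnstile> \<psi>" using assms by (auto elim: derives_mono)
  moreover have "?S \<tturnstile> (\<phi> \<^bold>\<longrightarrow> neg \<psi>)" by (auto intro: hyp)
  ultimately show "?S \<tturnstile> Bot" using mp explosion by metis
qed

lemma conj_list_elem: "\<phi> \<in> set L \<Longrightarrow> {conj_list L} \<tturnstile> \<phi>"
proof (induction L rule: conj_list.induct)
  case (2 \<psi>)
  then show ?case by (auto intro: hyp)
next
  case (3 \<psi> \<chi> L)
  show ?case
  proof (cases "\<phi> = \<psi>")
    case True
    then show ?thesis using And_left by simp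
  next
    case False
    then have "{conj_list (\<chi> # L)} \<tturnstile> \<phi>" using 3 by simp
    then show ?thesis by (rule derives_cut) (auto intro: And_right)
  qed
qed simp

text \<open>A derivation of \<open>Bot\<close> uses finitely many premises; their conjunction
  derives \<open>Bot\<close>, and the deduction theorem makes this a theorem forbidden by
  consistency.\<close>

lemma ldm_consistent_not_Bot:
  assumes "ldm_consistent S"
  shows "\<not> S \<tturnstile> Bot"
proof
  assume "S \<tturnstile> Bot"
  then obtain L where L: "set L \<subseteq> S" "set L \<tturnstile> Bot" using derives_compact by blast
  from L(2) have "{conj_list L} \<tturnstile> Bot" by (rule derives_cut) (rule conj_list_elem)
  then have "\<turnstile> conj_list L \<^bold>\<longrightarrow> Bot" by (intro derives_empty deduction)
  with L(1) assms show False by (auto simp: ldm_consistent_def)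
qed

subsection \<open>Maximal consistent sets\<close>

definition mcs :: "('v, 'i::{finite,linorder}) fm set \<Rightarrow> bool" where
  "mcs \<Gamma> \<longleftrightarrow> \<not> \<Gamma> \<tturnstile> Bot \<and> (\<forall>\<phi>. \<phi> \<in> \<Gamma> \<or> neg \<phi> \<in> \<Gamma>)"

text \<open>Zorn's lemma on the consistent supersets of \<open>S\<close>: a derivation of
  \<open>Bot\<close> from the union of a chain uses finitely many formulas, so it already lives in
  one member.\<close>

lemma lindenbaum:
  assumes "\<not> S \<tturnstile> Bot"
  obtains \<Gamma> where "mcs \<Gamma>" "S \<subseteq> \<Gamma>"
proof -
  let ?A = "{T. S \<subseteq> T \<and> \<not> T \<tturnstile> Bot}"
  have "\<exists>M\<in>?A. \<forall>X\<in>?A. M \<subseteq> X \<longrightarrow> X = M"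
  proof (rule subset_Zorn_nonempty)
    show "?A \<noteq> {}" using assms by blast
  next
    fix C assume C: "C \<noteq> {}" "subset.chain ?A C"
    have "\<not> \<Union>C \<tturnstile> Bot"
    proof
      assume "\<Union>C \<tturnstile> Bot"
      then obtain L where L: "set L \<subseteq> \<Union>C" "set L \<tturnstile> Bot" using derives_compact by blast
      obtain T where "T \<in> C" "set L \<subseteq> T"
        using finite_subset_Union_chain[OF finite_set L(1) C] by blast
      then show False using derives_mono[OF L(2)] C(2) by (auto simp: subset_chain_def)
    qed
    moreover have "S \<subseteq> \<Union>C" using C unfolding subset_chain_def by blast
    ultimately show "\<Union>C \<in> ?A" by simp
  qed
  then obtain \<Gamma> where "\<Gamma> \<in> ?A" and maximal: "\<forall>X\<in>?A. \<Gamma> \<subseteq> X \<longrightarrow> X = \<Gamma>" ..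
  then have \<Gamma>: "S \<subseteq> \<Gamma>" "\<not> \<Gamma> \<tturnstile> Bot" by simp_all
  have "\<phi> \<in> \<Gamma> \<or> neg \<phi> \<in> \<Gamma>" for \<phi>
  proof (rule ccontr)
    assume "\<not> ?thesis"
    \<comment> \<open>Maximality makes both proper extensions inconsistent: the second then yields
      \<open>\<phi>\<close>, the first its implication to \<open>Bot\<close>.\<close>
    then have "insert \<phi> \<Gamma> \<tturnstile> Bot" "insert (neg \<phi>) \<Gamma> \<tturnstile> Bot"
      using maximal[rule_format, of "insert \<phi> \<Gamma>"]
        maximal[rule_format, of "insert (neg \<phi>) \<Gamma>"] \<Gamma>(1) by blast+
    then have "\<Gamma> \<tturnstile> Bot" using mp[OF by_contradiction deduction] by blast
    with \<Gamma>(2) show False by blast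
  qed
  with \<Gamma> show thesis by (intro that) (auto simp: mcs_def)
qed

section \<open>Closure properties of maximal consistent sets\<close>

lemma mcs_neg: "mcs \<Gamma> \<Longrightarrow> neg \<phi> \<in> \<Gamma> \<longleftrightarrow> \<phi> \<notin> \<Gamma>"
  unfolding mcs_def using explosion[OF hyp hyp] by blast

lemma mcs_derives: "mcs \<Gamma> \<Longrightarrow> \<Gamma> \<tturnstile> \<phi> \<Longrightarrow> \<phi> \<in> \<Gamma>"
  unfolding mcs_def using explosion[OF _ hyp] by blast

lemma mcs_thm: "mcs \<Gamma> \<Longrightarrow> \<turnstile> \<phi> \<Longrightarrow> \<phi> \<in> \<Gamma>"
  by (blast intro: mcs_derives provable)

lemma mcs_mp: "mcs \<Gamma> \<Longrightarrow> \<phi> \<in> \<Gamma> \<Longrightarrow> \<turnstile> \<phi> \<^bold>\<longrightarrow> \<psi> \<Longrightarrow> \<psi> \<in> \<Gamma>"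
  using mcs_derives mp[OF hyp provable] by blast

lemma mcs_And: "mcs \<Gamma> \<Longrightarrow> (\<phi> \<^bold>\<and> \<psi>) \<in> \<Gamma> \<longleftrightarrow> \<phi> \<in> \<Gamma> \<and> \<psi> \<in> \<Gamma>"
  using mcs_derives[of \<Gamma>] And_intro[OF hyp hyp, of \<phi> \<Gamma> \<psi>]
    derives_mono[OF And_left, of \<phi> \<psi> \<Gamma>] derives_mono[OF And_right, of \<phi> \<psi> \<Gamma>]
  by blast

lemma mcs_Or: "mcs \<Gamma> \<Longrightarrow> (\<phi> \<^bold>\<or> \<psi>) \<in> \<Gamma> \<longleftrightarrow> \<phi> \<in> \<Gamma> \<or> \<psi> \<in> \<Gamma>"
  using mcs_And[of \<Gamma> "neg \<phi>" "neg \<psi>"] mcs_neg[of \<Gamma> "\<phi> \<^bold>\<or> \<psi>"] by (auto simp: mcs_neg)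

lemma mcs_conj_list: "mcs \<Gamma> \<Longrightarrow> conj_list L \<in> \<Gamma> \<longleftrightarrow> set L \<subseteq> \<Gamma>"
proof (induction L rule: conj_list.induct)
  case 1
  then show ?case by (auto simp: Top_def mcs_Or mcs_neg[of _ "Pos _", simplified])
qed (auto simp: mcs_And)

lemma mcs_conj_agents: "mcs \<Gamma> \<Longrightarrow> conj_agents \<Phi> \<in> \<Gamma> \<longleftrightarrow> (\<forall>i. \<Phi> i \<in> \<Gamma>)"
  by (auto simp: conj_agents_def mcs_conj_list)

subsection \<open>Canonical accessibility relations\<close>

lemma equiv_iff:
  "equiv A r \<longleftrightarrow> r \<subseteq> A \<times> A \<and> (\<forall>x\<in>A. (x, x) \<in> r) \<and> (\<forall>x y. (x, y) \<in> r \<longrightarrow> (y, x) \<in> r) \<and>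
    (\<forall>x y z. (x, y) \<in> r \<longrightarrow> (y, z) \<in> r \<longrightarrow> (x, z) \<in> r)"
  unfolding equiv_def refl_on_def sym_def trans_def by blast

text \<open>Settledness and each agent's modality share these laws, so their canonical relations are
  studied once. In negation normal form the diamond is primitive; \<open>neg_B\<close> ties it to
  the box.\<close>

locale s5_modality =
  fixes B D :: "('v, 'i::{finite,linorder}) fm \<Rightarrow> ('v, 'i) fm"
  assumes neg_B: "neg (B \<phi>) = D (neg \<phi>)"
    and nec: "\<turnstile> \<phi> \<Longrightarrow> \<turnstile> B \<phi>"
    and K: "\<turnstile> B (\<phi> \<^bold>\<longrightarrow> \<psi>) \<^bold>\<longrightarrow> (B \<phi> \<^bold>\<longrightarrow> B \<psi>)"
    and T: "\<turnstile> B \<phi> \<^bold>\<longrightarrow> \<phi>"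
    and five: "\<turnstile> D \<phi> \<^bold>\<longrightarrow> B (D \<phi>)"
begin

definition acc :: "(('v, 'i) fm set \<times> ('v, 'i) fm set) set" where
  "acc = {(\<Gamma>, \<Delta>). mcs \<Gamma> \<and> mcs \<Delta> \<and> (\<forall>\<phi>. B \<phi> \<in> \<Gamma> \<longrightarrow> \<phi> \<in> \<Delta>)}"

lemma accD: "(\<Gamma>, \<Delta>) \<in> acc \<Longrightarrow> B \<phi> \<in> \<Gamma> \<Longrightarrow> \<phi> \<in> \<Delta>"
  by (simp add: acc_def)

lemma acc_mcs: "(\<Gamma>, \<Delta>) \<in> acc \<Longrightarrow> mcs \<Gamma> \<and> mcs \<Delta>"
  by (simp add: acc_def)

lemma mcs_D: "mcs \<Gamma> \<Longrightarrow> D \<phi> \<in> \<Gamma> \<longleftrightarrow> B (neg \<phi>) \<notin> \<Gamma>"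
  using mcs_neg[of \<Gamma> "B (neg \<phi>)"] by (simp add: neg_B)

text \<open>A failure would put \<open>D (neg \<phi>)\<close> in the common source, and axiom 5
  would carry it to \<open>\<Delta>\<close>, against \<open>B \<phi>\<close> there.\<close>

lemma acc_euclidean:
  assumes "(\<Gamma>, \<Delta>) \<in> acc" "(\<Gamma>, \<Theta>) \<in> acc"
  shows "(\<Delta>, \<Theta>) \<in> acc"
proof -
  have "\<phi> \<in> \<Theta>" if "B \<phi> \<in> \<Delta>" for \<phi>
  proof (rule ccontr)
    assume "\<phi> \<notin> \<Theta>"
    then have "B \<phi> \<notin> \<Gamma>" using assms(2) accD by blast
    then have "D (neg \<phi>) \<in> \<Gamma>" using acc_mcs[OF assms(1)] by (simp add: mcs_D)
    then have "B (D (neg \<phi>)) \<in> \<Gamma>" using mcs_mp five acc_mcs[OF assms(1)] by blast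
    then have "D (neg \<phi>) \<in> \<Delta>" using assms(1) accD by blast
    then show False using that acc_mcs[OF assms(1)] by (simp add: mcs_D)
  qed
  then show ?thesis using acc_mcs[OF assms(1)] acc_mcs[OF assms(2)] by (simp add: acc_def)
qed

lemma equiv_acc: "equiv (Collect mcs) acc"
proof -
  have refl: "(\<Gamma>, \<Gamma>) \<in> acc" if "mcs \<Gamma>" for \<Gamma>
    using that mcs_mp T by (auto simp: acc_def)
  \<comment> \<open>The Euclidean property applied to the given pair and the reflexive pair at
    \<open>\<Gamma>\<close>.\<close>
  then have sym: "(\<Delta>, \<Gamma>) \<in> acc" if "(\<Gamma>, \<Delta>) \<in> acc" for \<Gamma> \<Delta>
    using that acc_euclidean acc_mcs by blast
  have "(\<Gamma>, \<Theta>) \<in> acc" if "(\<Gamma>, \<Delta>) \<in> acc" "(\<Delta>, \<Theta>) \<in> acc" for \<Gamma> \<Delta> \<Theta>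
    using acc_euclidean[OF sym[OF that(1)] that(2)] .
  moreover have "acc \<subseteq> Collect mcs \<times> Collect mcs" by (auto simp: acc_def)
  ultimately show ?thesis
    unfolding equiv_iff using refl sym by blast
qed

text \<open>Boxing every line of a derivation: \<open>nec\<close> treats theorems and
  \<open>K\<close> treats modus ponens.\<close>

lemma derives_B:
  assumes "mcs \<Gamma>" "{\<psi>. B \<psi> \<in> \<Gamma>} \<tturnstile> \<phi>"
  shows "B \<phi> \<in> \<Gamma>"
  using assms(2)
proof (induction rule: derives.induct)
  case (provable \<phi>)
  then show ?case using assms(1) mcs_thm nec by blast
next
  case (mp \<phi> \<psi>)
  then have "\<Gamma> \<tturnstile> (B \<phi> \<^bold>\<longrightarrow> B \<psi>)" using derives.mp[OF derives.hyp derives.provable[OF K]] by blast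
  then show ?case using mp assms(1) mcs_derives derives.mp[OF derives.hyp] by blast
qed simp

text \<open>The witness extends \<open>neg \<phi>\<close> and everything boxed in
  \<open>\<Gamma>\<close>; were these inconsistent, \<open>derives_B\<close> would put
  \<open>B \<phi>\<close> in \<open>\<Gamma>\<close>.\<close>

lemma acc_witness:
  assumes "mcs \<Gamma>" "B \<phi> \<notin> \<Gamma>"
  obtains \<Delta> where "(\<Gamma>, \<Delta>) \<in> acc" "\<phi> \<notin> \<Delta>"
proof -
  have "\<not> insert (neg \<phi>) {\<psi>. B \<psi> \<in> \<Gamma>} \<tturnstile> Bot"
    using derives_B[OF assms(1) by_contradiction] assms(2) by blast
  then obtain \<Delta> where \<Delta>: "mcs \<Delta>" "insert (neg \<phi>) {\<psi>. B \<psi> \<in> \<Gamma>} \<subseteq> \<Delta>"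
    using lindenbaum by blast
  then have "(\<Gamma>, \<Delta>) \<in> acc" "\<phi> \<notin> \<Delta>" using assms(1) mcs_neg[of \<Delta> \<phi>] by (auto simp: acc_def)
  then show thesis by (rule that)
qed

lemma B_iff: "mcs \<Gamma> \<Longrightarrow> B \<phi> \<in> \<Gamma> \<longleftrightarrow> (\<forall>\<Delta>. (\<Gamma>, \<Delta>) \<in> acc \<longrightarrow> \<phi> \<in> \<Delta>)"
  using acc_witness accD by metis

lemma D_iff: "mcs \<Gamma> \<Longrightarrow> D \<phi> \<in> \<Gamma> \<longleftrightarrow> (\<exists>\<Delta>. (\<Gamma>, \<Delta>) \<in> acc \<and> \<phi> \<in> \<Delta>)"
  using B_iff[of \<Gamma> "neg \<phi>"] acc_mcs mcs_neg mcs_D by blast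

lemma B_conj_list:
  assumes "mcs \<Gamma>"
  shows "B (conj_list L) \<in> \<Gamma> \<longleftrightarrow> (\<forall>\<phi>\<in>set L. B \<phi> \<in> \<Gamma>)"
  using assms acc_mcs by (auto simp: B_iff mcs_conj_list subset_iff)

end

section \<open>The concrete modalities and independence of agents\<close>

lemma AgBox_nec: "\<turnstile> \<phi> \<Longrightarrow> \<turnstile> AgBox i \<phi>"
  by (rule MP[OF Nec Bridge])

interpretation Box: s5_modality Box Dia
  by unfold_locales (auto intro: Nec Box_K[simplified] Box_T[simplified] Box_5[simplified])

interpretation AgBox: s5_modality "AgBox i" "AgDia i" for i
  by unfold_locales
    (auto intro: AgBox_nec AgBox_K[simplified] AgBox_T[simplified] AgBox_5[simplified])

lemma AgBox_acc_subset: "AgBox.acc i \<subseteq> Box.acc"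
  unfolding AgBox.acc_def Box.acc_def using mcs_mp Bridge by blast

text \<open>This is (C2) on maximal consistent sets. The formulas boxed for each agent at its own
  \<open>u i\<close> are jointly consistent, since IOA realises any finite choice of them in one
  set.\<close>

lemma acc_independence:
  fixes u :: "'i::{finite,linorder} \<Rightarrow> ('v, 'i) fm set"
  assumes u: "\<And>i j. (u i, u j) \<in> Box.acc"
  obtains \<Delta> where "\<And>i. (u i, \<Delta>) \<in> AgBox.acc i"
proof -
  have u_mcs: "mcs (u i)" for i using u Box.acc_mcs by blast
  let ?S = "\<Union>i. {\<phi>. AgBox i \<phi> \<in> u i}"
  have "\<not> ?S \<tturnstile> Bot"
  proof
    assume "?S \<tturnstile> Bot"
    then obtain L where L: "set L \<subseteq> ?S" "set L \<tturnstile> Bot" using derives_compact by blast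
    \<comment> \<open>The share of agent \<open>i\<close> in the finite contradiction; an agent
      without a share gets \<open>Top\<close>.\<close>
    define \<Phi> where "\<Phi> i = conj_list (filter (\<lambda>\<phi>. AgBox i \<phi> \<in> u i) L)" for i
    \<comment> \<open>IOA is applied at the set of an arbitrary agent, from which all
      \<open>u i\<close> are accessible.\<close>
    fix k :: 'i
    have "AgBox i (\<Phi> i) \<in> u i" for i
      using u_mcs by (simp add: \<Phi>_def AgBox.B_conj_list)
    then have "Dia (AgBox i (\<Phi> i)) \<in> u k" for i
      using u u_mcs Box.D_iff by blast
    then have "conj_agents (\<lambda>i. Dia (AgBox i (\<Phi> i))) \<in> u k"
      using u_mcs by (simp add: mcs_conj_agents)
    then have "Dia (conj_agents (\<lambda>i. AgBox i (\<Phi> i))) \<in> u k"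
      using u_mcs IOA mcs_mp by blast
    then obtain \<Theta> where \<Theta>: "mcs \<Theta>" "conj_agents (\<lambda>i. AgBox i (\<Phi> i)) \<in> \<Theta>"
      using u_mcs Box.D_iff Box.acc_mcs by metis
    then have "\<Phi> i \<in> \<Theta>" for i
      using AgBox_T mcs_mp by (metis mcs_conj_agents)
    \<comment> \<open>Each member of \<open>L\<close> is boxed in some \<open>u i\<close>, hence a
      conjunct of that \<open>\<Phi> i\<close>.\<close>
    then have "set L \<subseteq> \<Theta>"
      using L(1) \<Theta>(1) by (fastforce simp: \<Phi>_def mcs_conj_list)
    then show False using \<Theta>(1) L(2) derives_mono by (auto simp: mcs_def)
  qed
  then obtain \<Delta> where "mcs \<Delta>" "?S \<subseteq> \<Delta>" using lindenbaum by blast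
  then have "(u i, \<Delta>) \<in> AgBox.acc i" for i using u_mcs by (auto simp: AgBox.acc_def)
  then show thesis by (rule that)
qed

subsection \<open>The temporal canonical model\<close>

text \<open>One construction serves \<open>RBox\<close>, \<open>R\<close> and \<open>RAg\<close>;
  the clause \<open>mcs \<Gamma>\<close> keeps the later identities inside the set of
  worlds.\<close>

definition at_zero :: "(('v, 'i::{finite,linorder}) fm set \<times> ('v, 'i) fm set) set \<Rightarrow>
    (('v, 'i) world \<times> ('v, 'i) world) set" where
  "at_zero r = {((\<Gamma>, m), (\<Delta>, n)). m = n \<and> (if m = 0 then (\<Gamma>, \<Delta>) \<in> r else \<Gamma> = \<Delta> \<and> mcs \<Gamma>)}"

lemma at_zero_iff [simp]:
  "((\<Gamma>, m), (\<Delta>, n)) \<in> at_zero r \<longleftrightarrow>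
    m = n \<and> (if m = 0 then (\<Gamma>, \<Delta>) \<in> r else \<Gamma> = \<Delta> \<and> mcs \<Gamma>)"
  by (simp add: at_zero_def)

lemma equiv_at_zero:
  assumes "equiv (Collect mcs) r"
  shows "equiv (Collect mcs \<times> UNIV) (at_zero r)"
proof -
  have sub: "r \<subseteq> Collect mcs \<times> Collect mcs" and refl: "\<And>\<Gamma>. mcs \<Gamma> \<Longrightarrow> (\<Gamma>, \<Gamma>) \<in> r"
    and sym: "\<And>\<Gamma> \<Delta>. (\<Gamma>, \<Delta>) \<in> r \<Longrightarrow> (\<Delta>, \<Gamma>) \<in> r"
    and trans: "\<And>\<Gamma> \<Delta> \<Theta>. (\<Gamma>, \<Delta>) \<in> r \<Longrightarrow> (\<Delta>, \<Theta>) \<in> r \<Longrightarrow> (\<Gamma>, \<Theta>) \<in> r"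
    using assms unfolding equiv_iff by blast+
  show ?thesis
    unfolding equiv_iff
  proof (intro conjI)
    show "at_zero r \<subseteq> (Collect mcs \<times> UNIV) \<times> (Collect mcs \<times> UNIV)"
      using sub by (auto simp: at_zero_def split: if_splits)
  qed (auto simp: refl sym split: if_splits intro: trans)
qed

lemma AgBox_acc_refl: "mcs \<Gamma> \<Longrightarrow> (\<Gamma>, \<Gamma>) \<in> AgBox.acc i"
  using AgBox.equiv_acc unfolding equiv_iff by blast

definition canonical :: "(('v, 'i::{finite,linorder}) world, 'i, 'v) model" where
  "canonical = \<lparr>
     W = Collect mcs \<times> UNIV,
     RBox = at_zero Box.acc,
     R = (\<lambda>i. at_zero (AgBox.acc i)),
     RAg = at_zero (\<Inter>i. AgBox.acc i),
     RG = {((\<Gamma>, m), (\<Delta>, n)). \<Gamma> = \<Delta> \<and> mcs \<Gamma> \<and> m < n},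
     RH = {((\<Gamma>, m), (\<Delta>, n)). \<Gamma> = \<Delta> \<and> mcs \<Gamma> \<and> n < m},
     V = (\<lambda>p. {\<Gamma>. mcs \<Gamma> \<and> Pos p \<in> \<Gamma>} \<times> UNIV)\<rparr>"

lemma canonical_simps [simp]:
  "W canonical = Collect mcs \<times> UNIV"
  "RBox canonical = at_zero Box.acc"
  "R canonical i = at_zero (AgBox.acc i)"
  "RAg canonical = at_zero (\<Inter>i. AgBox.acc i)"
  "RG canonical = {((\<Gamma>, m), (\<Delta>, n)). \<Gamma> = \<Delta> \<and> mcs \<Gamma> \<and> m < n}"
  "RH canonical = {((\<Gamma>, m), (\<Delta>, n)). \<Gamma> = \<Delta> \<and> mcs \<Gamma> \<and> n < m}"
  "V canonical p = {\<Gamma>. mcs \<Gamma> \<and> Pos p \<in> \<Gamma>} \<times> UNIV"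
  by (simp_all add: canonical_def)

text \<open>Modal steps from moment \<open>0\<close> stay at moment \<open>0\<close>, so the
  induction needs only the canonical relations.\<close>

lemma canonical_truth: "mcs \<Gamma> \<Longrightarrow> sat canonical (\<Gamma>, 0) \<phi> \<longleftrightarrow> \<phi> \<in> \<Gamma>"
proof (induction \<phi> arbitrary: \<Gamma>)
  case (Neg p)
  then show ?case using mcs_neg[of \<Gamma> "Pos p"] by simp
next
  case (Box \<phi>)
  have "sat canonical (\<Gamma>, 0) (Box \<phi>) \<longleftrightarrow> (\<forall>\<Delta>. (\<Gamma>, \<Delta>) \<in> Box.acc \<longrightarrow> sat canonical (\<Delta>, 0) \<phi>)"
    by auto
  then show ?case using Box Box.B_iff Box.acc_mcs by metis
next
  case (Dia \<phi>)
  have "sat canonical (\<Gamma>, 0) (Dia \<phi>) \<longleftrightarrow> (\<exists>\<Delta>. (\<Gamma>, \<Delta>) \<in> Box.acc \<and> sat canonical (\<Delta>, 0) \<phi>)"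
    by auto
  then show ?case using Dia Box.D_iff Box.acc_mcs by metis
next
  case (AgBox i \<phi>)
  have "sat canonical (\<Gamma>, 0) (AgBox i \<phi>) \<longleftrightarrow>
      (\<forall>\<Delta>. (\<Gamma>, \<Delta>) \<in> AgBox.acc i \<longrightarrow> sat canonical (\<Delta>, 0) \<phi>)"
    by auto
  then show ?case using AgBox AgBox.B_iff AgBox.acc_mcs by metis
next
  case (AgDia i \<phi>)
  have "sat canonical (\<Gamma>, 0) (AgDia i \<phi>) \<longleftrightarrow>
      (\<exists>\<Delta>. (\<Gamma>, \<Delta>) \<in> AgBox.acc i \<and> sat canonical (\<Delta>, 0) \<phi>)"
    by auto
  then show ?case using AgDia AgBox.D_iff AgBox.acc_mcs by metis
qed (simp_all add: mcs_And mcs_Or)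

section \<open>Verification of the frame conditions\<close>

lemma equiv_INT:
  assumes "\<And>i. equiv A (r i)"
  shows "equiv A (\<Inter>i. r i)"
proof -
  have "r i \<subseteq> A \<times> A" "x \<in> A \<Longrightarrow> (x, x) \<in> r i" "(x, y) \<in> r i \<Longrightarrow> (y, x) \<in> r i"
    "(x, y) \<in> r i \<Longrightarrow> (y, z) \<in> r i \<Longrightarrow> (x, z) \<in> r i" for i x y z
    using assms[of i] unfolding equiv_iff by blast+
  then show ?thesis
    unfolding equiv_iff INT_iff by (intro conjI) blast+
qed

lemma canonical_independence:
  assumes "\<And>i j. (u i, u j) \<in> at_zero Box.acc"
  shows "(\<Inter>i. at_zero (AgBox.acc i) `` {u i}) \<noteq> {}"
proof -
  fix k
  define v where "v i = fst (u i)" for i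
  have time: "snd (u i) = snd (u k)" for i
    using assms[of i k] by (auto simp: at_zero_def)
  then have u: "u i = (v i, snd (u k))" for i by (simp add: v_def prod_eq_iff)
  show ?thesis
  proof (cases "snd (u k) = 0")
    case True
    then have eq: "u i = (v i, 0)" for i using u[of i] by simp
    then have "(v i, v j) \<in> Box.acc" for i j using assms[of i j] by simp
    then obtain \<Delta> where "\<And>i. (v i, \<Delta>) \<in> AgBox.acc i" using acc_independence[of v] by blast
    then have "(\<Delta>, 0) \<in> (\<Inter>i. at_zero (AgBox.acc i) `` {u i})" by (simp add: eq)
    then show ?thesis by blast
  next
    case False
    \<comment> \<open>At later moments \<open>RBox\<close> is the identity, so all chosen worlds
      coincide and are their own common successor.\<close>
    have "u i = u k \<and> mcs (v k)" for i
      using assms[of i k] False u[of i] u[of k] by (metis at_zero_iff)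
    then have "(u i, u k) \<in> at_zero (AgBox.acc i)" for i
      using False u[of k] by (metis at_zero_iff)
    then show ?thesis by blast
  qed
qed

lemma canonical_frame:
  assumes "mcs (\<Gamma> :: ('v, 'i::{finite,linorder}) fm set)"
  shows "tstit_frame (canonical :: (('v, 'i) world, 'i, 'v) model)"
  unfolding tstit_frame_def canonical_simps
proof (intro conjI allI impI ballI)
  show "(Collect mcs \<times> UNIV :: (('v, 'i) world) set) \<noteq> {}" using assms by blast
  show "equiv (Collect mcs \<times> UNIV) (at_zero Box.acc)"
    by (intro equiv_at_zero Box.equiv_acc)
  show "equiv (Collect mcs \<times> UNIV) (at_zero (AgBox.acc i))" for i
    by (intro equiv_at_zero AgBox.equiv_acc)
  show "equiv (Collect mcs \<times> UNIV) (at_zero (\<Inter>i. AgBox.acc i))"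
    by (intro equiv_at_zero equiv_INT AgBox.equiv_acc)
  show "at_zero (AgBox.acc i) \<subseteq> at_zero Box.acc" for i
    by (auto simp: at_zero_def dest: subsetD[OF AgBox_acc_subset] split: if_splits)
  show "(\<Inter>i. at_zero (AgBox.acc i) `` {u i}) \<noteq> {}"
    if "(\<forall>i. u i \<in> Collect mcs \<times> UNIV) \<and> (\<forall>i j. (u i, u j) \<in> at_zero Box.acc)"
    for u :: "'i \<Rightarrow> ('v, 'i) world"
    using that by (intro canonical_independence) blast
  show "at_zero (\<Inter>i. AgBox.acc i) `` {w} = (\<Inter>i. at_zero (AgBox.acc i) `` {w})"
    for w :: "('v, 'i) world"
    \<comment> \<open>At moment \<open>0\<close> the intersection is taken inside
      \<open>at_zero\<close>; later both sides are \<open>{w}\<close>, or empty off the set of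
      worlds.\<close>
    by (cases w; cases "snd w = 0") auto
  show "\<exists>v\<in>Collect mcs \<times> UNIV. (w, v) \<in> {((\<Gamma>, m), (\<Delta>, n)). \<Gamma> = \<Delta> \<and> mcs \<Gamma> \<and> m < n}"
    if "w \<in> Collect mcs \<times> UNIV" for w :: "('v, 'i) world"
    using that by (auto intro!: bexI[of _ "(fst w, Suc (snd w))"])
\<comment> \<open>The order of the naturals gives transitivity and both linearity conditions. For
  (C6) the intermediate world is \<open>w\<close> itself, as \<open>RG\<close> lands at a positive
  moment; (C7) holds as \<open>RBox\<close> preserves the moment and \<open>RG\<close> increases
  it.\<close>
qed (auto simp: at_zero_def relcomp_unfold AgBox_acc_refl intro!: transI split: if_splits)

theorem theorem2:
  fixes \<Sigma> :: "('v::countable, 'i::{finite,linorder}) fm set"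
  assumes "ldm_consistent \<Sigma>"
  shows "\<exists>(M :: (('v, 'i) world, 'i, 'v) model) w.
           tstit_model M \<and> w \<in> W M \<and> (\<forall>\<phi>\<in>\<Sigma>. sat M w \<phi>)"
proof -
  obtain \<Gamma> where \<Gamma>: "mcs \<Gamma>" "\<Sigma> \<subseteq> \<Gamma>"
    using lindenbaum[OF ldm_consistent_not_Bot[OF assms]] .
  have "tstit_model (canonical :: (('v, 'i) world, 'i, 'v) model)"
    using canonical_frame[OF \<Gamma>(1)] by (auto simp: tstit_model_def)
  moreover have "(\<Gamma>, 0) \<in> W canonical" "\<forall>\<phi>\<in>\<Sigma>. sat canonical (\<Gamma>, 0) \<phi>"
    using \<Gamma> canonical_truth by auto
  ultimately show ?thesis by blast
qed

end
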